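(* Consider a nonlinear network, with the nodes split into central nodes $C$ and boundary nodes $B$, and with associated function $K(z)=\sum_{j=1}^m G_j((D^\top z)_j)$, $z=(z_C,z_B)$. Let Assumption A (global solvability) and Assumption B (constant reduced graph) be satisfied. Then the constraint equations $0=\frac{\partial K}{\partial z_C}(z_C,z_B)$ lead to a Kron reduced graph with incidence matrix $\widehat{D}$ and $\hat m$ edges. Let $\widehat{K}(z_B)=K(z_C(z_B),z_B)$, let $\widehat{G}:\mathbb{R}^{\hat m}\to\mathbb{R}$ be a twice differentiable function with $\widehat{K}(z_B)=\widehat{G}(\widehat{D}^\top z_B)$ for all $z_B$, let $\widehat{W}(\hat y)$, $\hat y\in\mathbb{R}^{\hat m}$, be diagonal matrices with $\widehat{W}(\widehat{D}^\top z_B)=W(z_B)$ for all $z_B$, let $F$ be a matrix with $\operatorname{im}F=\ker\widehat{D}$, and let $S(\hat y)$ be a symmetric matrix (depending on $\hat y$) such that $$\widehat{W}(\hat y)=\frac{\partial^2\widehat{G}}{\partial\hat y^2}(\hat y)+F\,S(\hat y)\,F^\top .$$ Assume additionally that the matrix $S(\hat y)$ is a Hessian matrix, or, equivalently, that its elements $S_{ij}(\hat y)$ satisfy the integrability conditions $$\frac{\partial S_{ij}}{\partial\hat y_k}(\hat y)=\frac{\partial S_{kj}}{\partial\hat y_i}(\hat y),\qquad i,j,k=1,\dots,\hat m .$$ Then there exist twice differentiable strongly convex functions $\widehat{G}_j:\mathbb{R}\to\mathbb{R}$, $j=1,\dots,\hat m$, which, placed on the edges of the Kron reduced graph, define a nonlinear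 network (in particular, the graph is connected) whose associated function is $\widehat{K}$, i.e. $\widehat{K}(z_B)=\sum_{j=1}^{\hat m}\widehat{G}_j\big((\widehat{D}^\top z_B)_j\big)$ for all $z_B$.
   Context: Conventions: a twice differentiable function is called strongly convex if its Hessian (second derivative, in the scalar case) is positive definite at every point. The incidence matrix $D$ of a finite directed graph with $n$ nodes and $m$ edges (no self-loops) is the $n\times m$ matrix whose $j$-th column has entry $+1$ at the head node of edge $j$, $-1$ at its tail node, and $0$ elsewhere. Nonlinear network: a connected directed graph with $n\times m$ incidence matrix $D$, where the $j$-th edge is endowed with a twice differentiable strongly convex function $G_j:\mathbb{R}\to\mathbb{R}$, $j=1,\dots,m$. Its associated function is $K:\mathbb{R}^n\to\mathbb{R}$, $K(z):=G(D^\top z)$ with $G(y):=\sum_{j=1}^m G_j(y_j)$. Splitting: the node set is split into a set of $n_B$ boundary nodes ($B$) and the complementary set of central nodes ($C$), and correspondingly $z=(z_C,z_B)$. Assumption A: for each $z_B\in\mathbb{R}^{n_B}$ the constraint equations $0=\frac{\partial K}{\partial z_C}(z_C,z_B)$ can be solved globally for $z_C$, resulting in a differentiable mapping $z_B\mapsto z_C(z_B)$ such that $\frac{\partial K}{\partial z_C}(z_C(z_B),z_B)=0$ for all $z_B$. Define $\widehat{K}(z_B):=K(z_C(z_B),z_B)$. Its Hessian at $z_B$ is the Schur complement of the Laplacian matrix $\frac{\partial^2K}{\partial z^2}(z_C(z_B),z_B)$ with respect to its $(C,C)$-block, and this Schur complement is again a Laplacian matrix. Kron reduced graph at $z_B$: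 the (arbitrarily oriented) graph with node set $B$ having an edge between distinct nodes $i,k\in B$ if and only if the $(i,k)$ entry of $\frac{\partial^2\widehat{K}}{\partial z_B^2}(z_B)$ is nonzero. Assumption B: the Kron reduced graph has the same incidence matrix $\widehat{D}$, of size $n_B\times\hat m$, for all $z_B$. $W(z_B)$ is the $\hat m\times\hat m$ diagonal matrix with positive diagonal elements satisfying $\frac{\partial^2\widehat{K}}{\partial z_B^2}(z_B)=\widehat{D}W(z_B)\widehat{D}^\top$. It depends only on $\widehat{D}^\top z_B$, because $\widehat{K}$ is invariant under shifts $z_B\mapsto z_B+c\mathbf{1}$, where $c\in\mathbb{R}$ and $\mathbf{1}$ is the all-ones vector; hence matrices $\widehat{W}(\hat y)$ as in the claim can be defined. *)

theory Defs
  imports "HOL-Analysis.Analysis" "Graph_Theory.Digraph_Component"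
begin

definition gradient :: "(real ^ 'n::finite \<Rightarrow> real) \<Rightarrow> real ^ 'n \<Rightarrow> real ^ 'n" where
  "gradient f x = (\<chi> i. frechet_derivative f (at x) (axis i 1))"

definition hessian :: "(real ^ 'n::finite \<Rightarrow> real) \<Rightarrow> real ^ 'n \<Rightarrow> real ^ 'n ^ 'n" where
  "hessian f x = matrix (frechet_derivative (gradient f) (at x))"

definition twice_differentiable :: "(real ^ 'n::finite \<Rightarrow> real) \<Rightarrow> bool" where
  "twice_differentiable f \<longleftrightarrow>
     (\<forall>x. f differentiable at x) \<and> (\<forall>x. gradient f differentiable at x)"

definition strongly_convex :: "(real \<Rightarrow> real) \<Rightarrow> bool" where
  "strongly_convex f \<longleftrightarrow>
     (\<forall>x. f differentiable at x) \<and> (\<forall>x. deriv f differentiable at x) \<and>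
     (\<forall>x. deriv (deriv f) x > 0)"

text \<open>Nodes and edges are indexed by whole finite types, so that vectors on nodes and edges
  have types \<open>real ^ 'n\<close> and \<open>real ^ 'm\<close>. Parallel edges are allowed. Connectedness ignores
  the orientation of the edges.\<close>

definition network_graph :: "('n::finite, 'm::finite) pre_digraph \<Rightarrow> bool" where
  "network_graph N \<longleftrightarrow> verts N = UNIV \<and> arcs N = UNIV \<and>
     loopfree_digraph N \<and> Digraph_Component.connected N"

definition incidence_matrix :: "('n::finite, 'm::finite) pre_digraph \<Rightarrow> real ^ 'm ^ 'n" where
  "incidence_matrix N =
     (\<chi> i j. if i = head N j then 1 else if i = tail N j then - 1 else 0)"

definition nonlinear_network ::
    "('n::finite, 'm::finite) pre_digraph \<Rightarrow> ('m \<Rightarrow> real \<Rightarrow> real) \<Rightarrow> bool" where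
  "nonlinear_network N G \<longleftrightarrow> network_graph N \<and> (\<forall>j. strongly_convex (G j))"

definition associated_function ::
    "('n::finite, 'm::finite) pre_digraph \<Rightarrow> ('m \<Rightarrow> real \<Rightarrow> real) \<Rightarrow> real ^ 'n \<Rightarrow> real" where
  "associated_function N G z =
     (\<Sum>j\<in>UNIV. G j ((transpose (incidence_matrix N) *v z) $ j))"

text \<open>The splitting is given by an injection \<open>bnd :: 'b \<Rightarrow> 'n\<close>: the boundary nodes are
  \<open>range bnd\<close>, the central nodes its complement (which may be empty). \<open>combine bnd zC zB\<close> is the
  vector \<open>(z\<^sub>C, z\<^sub>B)\<close>; the values of \<open>zC\<close> at boundary nodes are irrelevant.\<close>

definition combine :: "('b::finite \<Rightarrow> 'n::finite) \<Rightarrow> ('n \<Rightarrow> real) \<Rightarrow> real ^ 'b \<Rightarrow> real ^ 'n" where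
  "combine bnd zC zB = (\<chi> i. if i \<in> range bnd then zB $ inv bnd i else zC i)"

definition solves_constraints ::
    "(real ^ 'n::finite \<Rightarrow> real) \<Rightarrow> ('b::finite \<Rightarrow> 'n) \<Rightarrow> (real ^ 'b \<Rightarrow> 'n \<Rightarrow> real) \<Rightarrow> bool" where
  "solves_constraints K bnd zC \<longleftrightarrow>
     (\<forall>i. i \<notin> range bnd \<longrightarrow> (\<forall>zB. (\<lambda>zB. zC zB i) differentiable at zB)) \<and>
     (\<forall>zB. \<forall>i. i \<notin> range bnd \<longrightarrow> gradient K (combine bnd (zC zB) zB) $ i = 0)"

definition reduced_function ::
    "(real ^ 'n::finite \<Rightarrow> real) \<Rightarrow> ('b::finite \<Rightarrow> 'n) \<Rightarrow> (real ^ 'b \<Rightarrow> 'n \<Rightarrow> real) \<Rightarrow> real ^ 'b \<Rightarrow> real"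
  where "reduced_function K bnd zC zB = K (combine bnd (zC zB) zB)"

text \<open>\<open>N\<close> is an arbitrary orientation of the simple graph on the index set of \<open>L\<close> that has the
  edge \<open>{i, k}\<close> exactly when the off-diagonal entry \<open>L $ i $ k\<close> is nonzero. The bijection
  excludes self-loops and parallel edges.\<close>

definition oriented_graph_of_matrix ::
    "real ^ 'b ^ 'b \<Rightarrow> ('b::finite, 'm::finite) pre_digraph \<Rightarrow> bool" where
  "oriented_graph_of_matrix L N \<longleftrightarrow> verts N = UNIV \<and> arcs N = UNIV \<and>
     bij_betw (\<lambda>e. {tail N e, head N e}) UNIV {{i, k} | i k. i \<noteq> k \<and> L $ i $ k \<noteq> 0}"

definition kron_reduced_graph_at ::
    "(real ^ 'b::finite \<Rightarrow> real) \<Rightarrow> real ^ 'b \<Rightarrow> ('b, 'm::finite) pre_digraph \<Rightarrow> bool" where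
  "kron_reduced_graph_at Khat zB N \<longleftrightarrow> oriented_graph_of_matrix (hessian Khat zB) N"

definition diagonal :: "real ^ 'm ^ 'm::finite \<Rightarrow> bool" where
  "diagonal A \<longleftrightarrow> (\<forall>i j. i \<noteq> j \<longrightarrow> A $ i $ j = 0)"

definition hessian_matrix_field :: "(real ^ 'm::finite \<Rightarrow> real ^ 'm ^ 'm) \<Rightarrow> bool" where
  "hessian_matrix_field S \<longleftrightarrow> (\<exists>h. twice_differentiable h \<and> (\<forall>y. S y = hessian h y))"

definition integrability_conditions :: "(real ^ 'm::finite \<Rightarrow> real ^ 'm ^ 'm) \<Rightarrow> bool" where
  "integrability_conditions S \<longleftrightarrow>
     (\<forall>i j y. (\<lambda>y. S y $ i $ j) differentiable at y) \<and>
     (\<forall>i j k y. frechet_derivative (\<lambda>y. S y $ i $ j) (at y) (axis k 1) =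
                frechet_derivative (\<lambda>y. S y $ k $ j) (at y) (axis i 1))"

end

theory Submission
  imports Defs
begin

text \<open>
  The reduced function is determined by \<open>Ghat\<close> on the cut space \<open>U = im Dhat\<^sup>T\<close>, and \<open>U\<close> is the
  orthogonal complement of \<open>ker Dhat = im F\<close>. So \<open>F\<^sup>T\<close> vanishes on \<open>U\<close>, and the correction
  \<open>F S(y) F\<^sup>T\<close> disappears as soon as the matrix identity for \<open>What y\<close> is applied to a vector
  \<open>u \<in> U\<close>: there \<open>hessian Ghat y *v u = What y *v u\<close>, and \<open>What y\<close> is diagonal. Hence the derivative
  of \<open>\<partial>\<^sub>j Ghat\<close> in the direction \<open>u\<close> is \<open>What\<^sub>j\<^sub>j(y) u\<^sub>j\<close>. It is zero when \<open>u\<^sub>j = 0\<close>, so that on \<open>U\<close> the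
  partial derivative \<open>\<partial>\<^sub>j Ghat\<close> is a function \<open>g\<^sub>j\<close> of \<open>y\<^sub>j\<close> alone
  (\<open>partial_derivative_one_variable\<close>). The derivative of \<open>g\<^sub>j\<close> is a diagonal entry of \<open>W\<close>,
  hence positive, and antiderivatives of the \<open>g\<^sub>j\<close>, normalised at \<open>0\<close>, are the required
  edge functions (\<open>separable_on_subspace\<close>).

  The reduced graph is connected for a convexity reason. Otherwise some non-constant \<open>v\<close> satisfies
  \<open>Dhat\<^sup>T v = 0\<close>, and then \<open>Khat\<close> is constant along the line through \<open>0\<close> with direction \<open>v\<close>.
  But \<open>K\<close> lies above its tangent planes, strictly so except along constant shifts because the
  original graph is connected, and at a solution of the constraint equations the tangent plane
  does not see the central nodes. So \<open>Khat\<close> is strictly convex in all directions but the constant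
  vectors (\<open>reduced_function_flat_direction\<close>).\<close>

section \<open>Connectedness in terms of potentials\<close>

lemma transpose_incidence_component:
  assumes "head N j \<noteq> tail N j"
  shows "(transpose (incidence_matrix N) *v z) $ j = z $ head N j - z $ tail N j"
proof -
  have "(transpose (incidence_matrix N) *v z) $ j
      = (\<Sum>i\<in>UNIV. (if i = head N j then z $ i else 0) - (if i = tail N j then z $ i else 0))"
    using assms
    by (auto simp: matrix_vector_mult_def transpose_def incidence_matrix_def intro!: sum.cong)
  then show ?thesis
    by (simp add: sum_subtractf)
qed

text \<open>A potential with zero difference across every edge is constant along walks; conversely the
  indicator of a connected component is such a potential.\<close>

lemma connected_iff_potentials_constant:
  fixes N :: "('n::finite, 'm::finite) pre_digraph"
  assumes univ: "verts N = UNIV" "arcs N = UNIV" and loopfree: "\<And>e. head N e \<noteq> tail N e"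
  shows "Digraph_Component.connected N \<longleftrightarrow>
    (\<forall>z. transpose (incidence_matrix N) *v z = 0 \<longrightarrow> (\<forall>i k. z $ i = z $ k))"
    (is "_ \<longleftrightarrow> ?potentials")
proof
  let ?S = "with_proj (mk_symmetric N)"
  have ends: "x \<rightarrow>\<^bsub>?S\<^esub> y \<longleftrightarrow>
      (\<exists>e. (x = tail N e \<and> y = head N e) \<or> (x = head N e \<and> y = tail N e))" for x y
    using univ by (auto simp: mk_symmetric_def arcs_ends_def arc_to_ends_def)
  {
    assume con: "Digraph_Component.connected N"
    show ?potentials
    proof (intro allI impI)
      fix z i k
      assume z: "transpose (incidence_matrix N) *v z = 0"
      have edge: "z $ head N e = z $ tail N e" for e
        using transpose_incidence_component[of N e z, OF loopfree] z by simp
      have "i \<rightarrow>\<^sup>*\<^bsub>?S\<^esub> k"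
        using con univ
        by (auto simp: Digraph_Component.connected_def strongly_connected_def mk_symmetric_def)
      then have "(i, k) \<in> (arcs_ends ?S)\<^sup>*" by (rule reachable_rtranclI)
      then show "z $ i = z $ k"
      proof (induction rule: rtrancl_induct)
        case (step x y)
        then show ?case using edge ends[of x y] by auto
      qed simp
    qed
  next
    assume pot: ?potentials
    have "i \<rightarrow>\<^sup>*\<^bsub>?S\<^esub> k" for i k
    proof -
      let ?z = "\<chi> v. if i \<rightarrow>\<^sup>*\<^bsub>?S\<^esub> v then 1 else (0 :: real)"
      have step: "i \<rightarrow>\<^sup>*\<^bsub>?S\<^esub> y" if "i \<rightarrow>\<^sup>*\<^bsub>?S\<^esub> x" "x \<rightarrow>\<^bsub>?S\<^esub> y" for x y
      proof -
        have "y \<in> verts ?S" using univ by (simp add: mk_symmetric_def)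
        with that show ?thesis
          unfolding reachable_def by (auto intro: rtrancl_on_into_rtrancl_on)
      qed
      have "i \<rightarrow>\<^sup>*\<^bsub>?S\<^esub> head N e \<longleftrightarrow> i \<rightarrow>\<^sup>*\<^bsub>?S\<^esub> tail N e" for e
        using step ends by blast
      then have "transpose (incidence_matrix N) *v ?z = 0"
        by (simp add: vec_eq_iff transpose_incidence_component[OF loopfree] del: transpose_matrix_vector)
      then have "?z $ i = ?z $ k" using pot by blast
      moreover have "i \<rightarrow>\<^sup>*\<^bsub>?S\<^esub> i"
        using univ by (simp add: reachable_def rtrancl_on_refl mk_symmetric_def)
      ultimately show ?thesis by (auto split: if_splits)
    qed
    then show "Digraph_Component.connected N"
      using univ
      by (auto simp: Digraph_Component.connected_def strongly_connected_def mk_symmetric_def)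
  }
qed

section \<open>Gradients and Hessians\<close>

lemma has_derivative_gradient:
  fixes f :: "real ^ 'n::finite \<Rightarrow> real"
  assumes "f differentiable at x"
  shows "(f has_derivative (\<lambda>h. gradient f x \<bullet> h)) (at x)"
proof -
  let ?f' = "frechet_derivative f (at x)"
  have der: "(f has_derivative ?f') (at x)"
    using assms frechet_derivative_works by blast
  have "?f' h = gradient f x \<bullet> h" for h
  proof -
    have "?f' h = ?f' (\<Sum>i\<in>UNIV. h $ i *\<^sub>R axis i 1)"
      using basis_expansion[of h] by (simp add: scalar_mult_eq_scaleR)
    also have "\<dots> = (\<Sum>i\<in>UNIV. h $ i * ?f' (axis i 1))"
      using has_derivative_linear[OF der] by (simp add: linear_sum linear_scale)
    finally show ?thesis by (simp add: gradient_def inner_vec_def mult.commute)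
  qed
  then have "?f' = (\<lambda>h. gradient f x \<bullet> h)" by (rule ext)
  with der show ?thesis by simp
qed

lemma has_derivative_hessian:
  assumes "twice_differentiable f"
  shows "(gradient f has_derivative (\<lambda>h. hessian f x *v h)) (at x)"
proof -
  have der: "(gradient f has_derivative frechet_derivative (gradient f) (at x)) (at x)"
    using assms frechet_derivative_works unfolding twice_differentiable_def by blast
  then show ?thesis
    using der matrix_vector_mul(2)[OF has_derivative_linear[OF der]]
    by (simp add: hessian_def)
qed

lemma DERIV_along_line:
  fixes f :: "real ^ 'n::finite \<Rightarrow> real"
  assumes "f differentiable at (y + t *\<^sub>R u)"
  shows "((\<lambda>t. f (y + t *\<^sub>R u)) has_real_derivative gradient f (y + t *\<^sub>R u) \<bullet> u) (at t)"
proof -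
  have "((\<lambda>t. y + t *\<^sub>R u) has_derivative (\<lambda>s. s *\<^sub>R u)) (at t)"
    using has_derivative_add[OF has_derivative_const[of y]
        has_derivative_scaleR_left[OF has_derivative_ident, of u]] by simp
  from has_derivative_compose[where g = f, OF this has_derivative_gradient[OF assms]]
  have "((\<lambda>t. f (y + t *\<^sub>R u)) has_derivative (\<lambda>s. gradient f (y + t *\<^sub>R u) \<bullet> (s *\<^sub>R u))) (at t)" .
  then show ?thesis
    by (rule has_derivative_imp_has_field_derivative) simp
qed

lemma DERIV_gradient_along_line:
  fixes f :: "real ^ 'n::finite \<Rightarrow> real"
  assumes "twice_differentiable f"
  shows "((\<lambda>t. gradient f (y + t *\<^sub>R u) $ j) has_real_derivative
    (hessian f (y + t *\<^sub>R u) *v u) $ j) (at t)"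
proof -
  have "((\<lambda>t. y + t *\<^sub>R u) has_derivative (\<lambda>s. s *\<^sub>R u)) (at t)"
    using has_derivative_add[OF has_derivative_const[of y]
        has_derivative_scaleR_left[OF has_derivative_ident, of u]] by simp
  from has_derivative_compose[where g = "gradient f", OF this has_derivative_hessian[OF assms]]
  have "((\<lambda>t. gradient f (y + t *\<^sub>R u)) has_derivative
      (\<lambda>s. hessian f (y + t *\<^sub>R u) *v (s *\<^sub>R u))) (at t)" .
  then have "((\<lambda>t. gradient f (y + t *\<^sub>R u) $ j) has_derivative
      (\<lambda>s. (hessian f (y + t *\<^sub>R u) *v (s *\<^sub>R u)) $ j)) (at t)"
    by (rule bounded_linear.has_derivative[OF bounded_linear_vec_nth])
  then show ?thesis
    by (rule has_derivative_imp_has_field_derivative) (simp add: matrix_vector_mult_scaleR)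
qed

lemma diagonal_mult_component:
  assumes "diagonal A"
  shows "(A *v u) $ j = A $ j $ j * u $ j"
proof -
  have "(\<Sum>k\<in>UNIV. A $ j $ k * u $ k) = (\<Sum>k\<in>{j}. A $ j $ k * u $ k)"
    using assms by (intro sum.mono_neutral_right) (auto simp: diagonal_def)
  then show ?thesis by (simp add: matrix_vector_mult_def)
qed

section \<open>Strict convexity of the network function\<close>

lemma strongly_convex_above_tangent:
  assumes f: "strongly_convex f" and neq: "x \<noteq> y"
  shows "f x + deriv f x * (y - x) < f y"
proof -
  have D: "(f has_real_derivative deriv f t) (at t)"
    and DD: "(deriv f has_real_derivative deriv (deriv f) t) (at t)"
    and pos: "deriv (deriv f) t > 0" for t
    using f by (auto simp: strongly_convex_def DERIV_deriv_iff_real_differentiable)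
  have mono: "deriv f s < deriv f t" if "s < t" for s t
    using DERIV_pos_imp_increasing[OF that, of "deriv f"] DD pos by blast
  show ?thesis
  proof (cases "x < y")
    case True
    then obtain c where "x < c" "f y - f x = (y - x) * deriv f c"
      using MVT2[of x y f "deriv f"] D by blast
    moreover have "(y - x) * deriv f x < (y - x) * deriv f c"
      using \<open>x < y\<close> \<open>x < c\<close> mono by simp
    ultimately show ?thesis by (simp add: algebra_simps)
  next
    case False
    with neq have "y < x" by simp
    then obtain c where "c < x" "f x - f y = (x - y) * deriv f c"
      using MVT2[of y x f "deriv f"] D by blast
    moreover have "(x - y) * deriv f c < (x - y) * deriv f x"
      using \<open>y < x\<close> \<open>c < x\<close> mono by simp
    ultimately show ?thesis by (simp add: algebra_simps)
  qed
qed

lemma has_derivative_associated_function: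
  fixes N :: "('n::finite, 'm::finite) pre_digraph"
  assumes "\<And>j. strongly_convex (G j)"
  shows "(associated_function N G has_derivative
    (\<lambda>h. \<Sum>j\<in>UNIV. deriv (G j) ((transpose (incidence_matrix N) *v z) $ j) *
      (transpose (incidence_matrix N) *v h) $ j)) (at z)"
proof -
  let ?A = "transpose (incidence_matrix N)"
  have "((\<lambda>z. (?A *v z) $ j) has_derivative (\<lambda>h. (?A *v h) $ j)) (at z)" for j
    by (rule bounded_linear.has_derivative[OF bounded_linear_vec_nth])
      (rule bounded_linear_imp_has_derivative, rule matrix_vector_mul_bounded_linear)
  moreover have "(G j has_derivative (\<lambda>h. deriv (G j) x * h)) (at x)" for j x
    using assms[of j]
    by (simp add: strongly_convex_def DERIV_deriv_iff_real_differentiable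
        flip: has_field_derivative_def)
  ultimately have "((\<lambda>z. G j ((?A *v z) $ j)) has_derivative
      (\<lambda>h. deriv (G j) ((?A *v z) $ j) * (?A *v h) $ j)) (at z)" for j
    by (rule has_derivative_compose)
  then show ?thesis
    unfolding associated_function_def[abs_def] by (intro has_derivative_sum)
qed

lemma associated_function_above_tangent:
  fixes N :: "('n::finite, 'm::finite) pre_digraph"
  assumes G: "\<And>j. strongly_convex (G j)"
    and neq: "transpose (incidence_matrix N) *v (z' - z) \<noteq> 0"
  shows "associated_function N G z + gradient (associated_function N G) z \<bullet> (z' - z)
    < associated_function N G z'"
proof -
  let ?A = "transpose (incidence_matrix N)" and ?K = "associated_function N G"
  let ?p = "\<lambda>j. (?A *v z) $ j" and ?q = "\<lambda>j. (?A *v z') $ j"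
  note der = has_derivative_associated_function[OF G, where N = N and z = z]
  have "gradient ?K z \<bullet> (z' - z) = (\<Sum>j\<in>UNIV. deriv (G j) (?p j) * (?A *v (z' - z)) $ j)"
    using fun_cong[OF has_derivative_unique[OF
        has_derivative_gradient[OF differentiableI[OF der]] der]] .
  also have "\<dots> = (\<Sum>j\<in>UNIV. deriv (G j) (?p j) * (?q j - ?p j))"
    by (simp add: matrix_vector_mult_diff_distrib)
  finally have "?K z + gradient ?K z \<bullet> (z' - z)
      = (\<Sum>j\<in>UNIV. G j (?p j) + deriv (G j) (?p j) * (?q j - ?p j))"
    by (simp add: associated_function_def sum.distrib)
  also have "\<dots> < (\<Sum>j\<in>UNIV. G j (?q j))"
  proof (rule sum_strict_mono_ex1)
    show "\<forall>j\<in>UNIV. G j (?p j) + deriv (G j) (?p j) * (?q j - ?p j) \<le> G j (?q j)"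
    proof
      fix j
      show "G j (?p j) + deriv (G j) (?p j) * (?q j - ?p j) \<le> G j (?q j)"
        using strongly_convex_above_tangent[OF G, of "?p j" "?q j" j]
        by (cases "?p j = ?q j") auto
    qed
    obtain j where "?q j \<noteq> ?p j"
      using neq by (auto simp: vec_eq_iff matrix_vector_mult_diff_distrib)
    then show "\<exists>j\<in>UNIV. G j (?p j) + deriv (G j) (?p j) * (?q j - ?p j) < G j (?q j)"
      using strongly_convex_above_tangent[OF G, of "?p j" "?q j" j] by auto
  qed simp
  finally show ?thesis by (simp add: associated_function_def)
qed

text \<open>Let \<open>z0\<close>, \<open>z1\<close>, \<open>z2\<close> be the network states over the boundary values \<open>b\<close>, \<open>b + v\<close>, \<open>b - v\<close>. The
  gradient of \<open>K\<close> at \<open>z0\<close> is zero on central nodes, so its products with \<open>z1 - z0\<close> and \<open>z2 - z0\<close>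
  depend only on the boundary parts \<open>v\<close> and \<open>-v\<close> and cancel. If \<open>v\<close> is not
  constant, the tangent inequalities at \<open>z0\<close> are strict, and their sum says that the reduced
  function at \<open>b\<close> is smaller than itself.\<close>

lemma reduced_function_flat_direction:
  fixes N :: "('n::finite, 'm::finite) pre_digraph"
    and bnd :: "'b::finite \<Rightarrow> 'n"
  assumes network: "nonlinear_network N G"
    and inj: "inj bnd"
    and crit: "solves_constraints (associated_function N G) bnd zC"
    and flat: "reduced_function (associated_function N G) bnd zC (b + v)
        = reduced_function (associated_function N G) bnd zC b"
      "reduced_function (associated_function N G) bnd zC (b - v)
        = reduced_function (associated_function N G) bnd zC b"
  shows "v $ i = v $ k"
proof (rule ccontr)
  assume v: "v $ i \<noteq> v $ k"
  let ?A = "transpose (incidence_matrix N)" and ?K = "associated_function N G"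
  let ?state = "\<lambda>b. combine bnd (zC b) b"
  let ?g = "gradient ?K (?state b)"
  have bdry: "?state b' $ bnd i = b' $ i" for b' i
    using inj by (simp add: combine_def)
  have central: "?g $ l = 0" if "l \<notin> range bnd" for l
    using crit that by (simp add: solves_constraints_def)
  have tangent: "?K (?state b) + ?g \<bullet> (?state b' - ?state b) < ?K (?state b')"
    if "(b' - b) $ i \<noteq> (b' - b) $ k" for b'
  proof (rule associated_function_above_tangent)
    show "strongly_convex (G j)" for j
      using network by (simp add: nonlinear_network_def)
    have "verts N = UNIV" "arcs N = UNIV" "head N e \<noteq> tail N e" "Digraph_Component.connected N"
      for e
      using network
      by (auto simp: nonlinear_network_def network_graph_def dest: loopfree_digraph.no_loops[of N e])
    then have "\<forall>z. ?A *v z = 0 \<longrightarrow> (\<forall>i k. z $ i = z $ k)"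
      by (simp add: connected_iff_potentials_constant)
    moreover have "(?state b' - ?state b) $ bnd i \<noteq> (?state b' - ?state b) $ bnd k"
      using that by (simp add: bdry)
    ultimately show "?A *v (?state b' - ?state b) \<noteq> 0" by blast
  qed
  have "?g \<bullet> (?state (b + v) - ?state b) + ?g \<bullet> (?state (b - v) - ?state b)
      = (\<Sum>l\<in>UNIV. ?g $ l *
          ((?state (b + v) - ?state b) $ l + (?state (b - v) - ?state b) $ l))"
    by (simp only: inner_vec_def inner_real_def distrib_left sum.distrib)
  also have "\<dots> = 0"
  proof (intro sum.neutral ballI)
    fix l
    show "?g $ l * ((?state (b + v) - ?state b) $ l + (?state (b - v) - ?state b) $ l) = 0"
    proof (cases "l \<in> range bnd")
      case True
      then obtain i' where "l = bnd i'" by blast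
      then show ?thesis by (simp add: bdry)
    qed (simp add: central)
  qed
  finally show False
    using tangent[of "b + v"] tangent[of "b - v"] flat v
    by (simp add: reduced_function_def)
qed

section \<open>Separation of variables on a subspace\<close>

text \<open>A vector of the subspace with \<open>j\<close>-th entry \<open>0\<close> is a direction in which the \<open>j\<close>-th partial
  derivative does not change, so on the subspace that derivative can be read off along the line
  through any \<open>e\<close> with \<open>e $ j = 1\<close>.\<close>

lemma partial_derivative_one_variable:
  fixes f :: "real ^ 'm::finite \<Rightarrow> real"
  assumes f: "twice_differentiable f"
    and U: "subspace U"
    and diag: "\<And>y u. y \<in> U \<Longrightarrow> u \<in> U \<Longrightarrow> (hessian f y *v u) $ j = w y * u $ j"
    and e: "e \<in> U" "e $ j = 1"
  obtains g where "\<And>y. y \<in> U \<Longrightarrow> gradient f y $ j = g (y $ j)"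
    and "\<And>t. (g has_real_derivative w (t *\<^sub>R e)) (at t)"
proof (rule that[of "\<lambda>t. gradient f (t *\<^sub>R e) $ j"])
  fix y assume y: "y \<in> U"
  define y0 where "y0 = (y $ j) *\<^sub>R e"
  have y0: "y0 \<in> U" "(y - y0) $ j = 0"
    using U e by (auto simp: y0_def subspace_scale)
  have "((\<lambda>t. gradient f (y0 + t *\<^sub>R (y - y0)) $ j) has_real_derivative 0) (at t)" for t
  proof -
    have "y0 + t *\<^sub>R (y - y0) \<in> U" "y - y0 \<in> U"
      using U y y0 by (auto intro!: subspace_add subspace_scale subspace_diff)
    then show ?thesis
      using DERIV_gradient_along_line[OF f, of y0 "y - y0" j t] y0 diag by simp
  qed
  then have "gradient f (y0 + 1 *\<^sub>R (y - y0)) $ j = gradient f (y0 + 0 *\<^sub>R (y - y0)) $ j"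
    using DERIV_isconst_all[of "\<lambda>t. gradient f (y0 + t *\<^sub>R (y - y0)) $ j" 1 0] by blast
  then show "gradient f y $ j = gradient f ((y $ j) *\<^sub>R e) $ j"
    by (simp add: y0_def)
next
  fix t
  have "t *\<^sub>R e \<in> U" using U e by (simp add: subspace_scale)
  then show "((\<lambda>t. gradient f (t *\<^sub>R e) $ j) has_real_derivative w (t *\<^sub>R e)) (at t)"
    using DERIV_gradient_along_line[OF f, of 0 e j t] diag e by simp
qed

lemma strongly_convex_antiderivative:
  assumes g: "\<And>t. \<exists>d>0. (g has_real_derivative d) (at t)"
  obtains F where "strongly_convex F" "F 0 = c" "\<And>t. (F has_real_derivative g t) (at t)"
proof -
  have "isCont g t" for t
    using g DERIV_isCont by blast
  then obtain F0 where "\<And>t. (F0 has_vector_derivative g t) (at t)"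
    using einterval_antiderivative[of "-\<infinity>" "\<infinity>" g] by auto
  then have F0: "(F0 has_real_derivative g t) (at t)" for t
    by (simp add: has_real_derivative_iff_has_vector_derivative)
  define F where "F t = F0 t - F0 0 + c" for t
  have F: "(F has_real_derivative g t) (at t)" for t
    unfolding F_def by (auto intro!: derivative_eq_intros F0)
  then have "deriv F = g" by (auto intro: DERIV_imp_deriv)
  moreover have "g differentiable at t" "deriv g t > 0" for t
    using g[of t] by (auto simp: real_differentiable_def DERIV_imp_deriv)
  ultimately have "strongly_convex F"
    using F by (auto simp: strongly_convex_def real_differentiable_def)
  then show ?thesis using that F by (simp add: F_def)
qed

text \<open>Since every partial derivative depends on one variable only, subtracting the antiderivatives
  leaves a function that is constant along the lines through \<open>0\<close> in the subspace.\<close>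

lemma separable_on_subspace:
  fixes f :: "real ^ 'm::finite \<Rightarrow> real"
  assumes f: "twice_differentiable f"
    and U: "subspace U"
    and diag: "\<And>y u j. y \<in> U \<Longrightarrow> u \<in> U \<Longrightarrow> (hessian f y *v u) $ j = w y j * u $ j"
    and pos: "\<And>y j. y \<in> U \<Longrightarrow> w y j > 0"
    and e: "\<And>j. \<exists>e\<in>U. e $ j = 1"
  shows "\<exists>Fs. (\<forall>j. strongly_convex (Fs j)) \<and> (\<forall>y\<in>U. f y = (\<Sum>j\<in>UNIV. Fs j (y $ j)))"
proof -
  (* The value of f at 0 is distributed evenly over the summands. *)
  have "\<exists>F g. strongly_convex F \<and> F 0 = f 0 / CARD('m) \<and>
      (\<forall>t. (F has_real_derivative g t) (at t)) \<and> (\<forall>y\<in>U. gradient f y $ j = g (y $ j))" for j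
  proof -
    obtain e where e: "e \<in> U" "e $ j = 1" using e by blast
    obtain g where g: "\<And>y. y \<in> U \<Longrightarrow> gradient f y $ j = g (y $ j)"
        "\<And>t. (g has_real_derivative w (t *\<^sub>R e) j) (at t)"
      using partial_derivative_one_variable[OF f U diag e] by blast
    have "w (t *\<^sub>R e) j > 0" for t
      using pos U e by (simp add: subspace_scale)
    then have "\<exists>d>0. (g has_real_derivative d) (at t)" for t using g by blast
    then obtain F where "strongly_convex F" "F 0 = f 0 / CARD('m)"
        "\<And>t. (F has_real_derivative g t) (at t)"
      by (rule strongly_convex_antiderivative) blast
    then show ?thesis using g by blast
  qed
  then obtain Fs gs where Fs: "\<And>j. strongly_convex (Fs j)" "\<And>j. Fs j 0 = f 0 / CARD('m)"
      "\<And>j t. (Fs j has_real_derivative gs j t) (at t)"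
      "\<And>j y. y \<in> U \<Longrightarrow> gradient f y $ j = gs j (y $ j)"
    by metis
  have "f y = (\<Sum>j\<in>UNIV. Fs j (y $ j))" if y: "y \<in> U" for y
  proof -
    let ?h = "\<lambda>t. f (t *\<^sub>R y) - (\<Sum>j\<in>UNIV. Fs j (t * y $ j))"
    have "(?h has_real_derivative 0) (at t)" for t
    proof -
      have "f differentiable at (0 + t *\<^sub>R y)"
        using f by (simp add: twice_differentiable_def)
      from DERIV_along_line[OF this]
      have 1: "((\<lambda>t. f (t *\<^sub>R y)) has_real_derivative gradient f (t *\<^sub>R y) \<bullet> y) (at t)"
        by simp
      have 2: "((\<lambda>t. Fs j (t * y $ j)) has_real_derivative gs j (t * y $ j) * y $ j) (at t)" for j
        by (rule DERIV_chain2[OF Fs(3)]) (auto intro!: derivative_eq_intros)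
      have "gradient f (t *\<^sub>R y) \<bullet> y = (\<Sum>j\<in>UNIV. gs j (t * y $ j) * y $ j)"
        using Fs(4)[OF subspace_scale[OF U y]] by (simp add: inner_vec_def)
      then show ?thesis
        using DERIV_diff[OF 1 DERIV_sum[of UNIV "\<lambda>t j. Fs j (t * y $ j)", OF 2]] by simp
    qed
    then have "?h 1 = ?h 0" using DERIV_isconst_all[of ?h 1 0] by blast
    then show ?thesis by (simp add: Fs(2))
  qed
  with Fs(1) show ?thesis by blast
qed

section \<open>The reduced network\<close>

theorem theorem2p10:
  fixes N :: "('n::finite, 'm::finite) pre_digraph"
    and G :: "'m \<Rightarrow> real \<Rightarrow> real"
    and K :: "real ^ 'n \<Rightarrow> real"
    and bnd :: "'b::finite \<Rightarrow> 'n"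
    and zC :: "real ^ 'b \<Rightarrow> 'n \<Rightarrow> real"
    and Khat :: "real ^ 'b \<Rightarrow> real"
    and Nhat :: "('b, 'mh::finite) pre_digraph"
    and Dhat :: "real ^ 'mh ^ 'b"
    and W :: "real ^ 'b \<Rightarrow> real ^ 'mh ^ 'mh"
    and Ghat :: "real ^ 'mh \<Rightarrow> real"
    and What S :: "real ^ 'mh \<Rightarrow> real ^ 'mh ^ 'mh"
    and F :: "real ^ 'mh ^ 'mh"
  assumes network: "nonlinear_network N G"
    and K_def: "K = associated_function N G"
    and splitting: "inj bnd"
    and assumption_A: "solves_constraints K bnd zC"
    and Khat_def: "Khat = reduced_function K bnd zC"
    and assumption_B: "\<And>zB. kron_reduced_graph_at Khat zB Nhat"
    and Dhat_def: "Dhat = incidence_matrix Nhat"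
    and W_diagonal: "\<And>zB. diagonal (W zB)"
    and W_positive: "\<And>zB j. W zB $ j $ j > 0"
    and W_hessian: "\<And>zB. hessian Khat zB = Dhat ** W zB ** transpose Dhat"
    and Ghat_diff: "twice_differentiable Ghat"
    and Ghat_Khat: "\<And>zB. Khat zB = Ghat (transpose Dhat *v zB)"
    and What_diagonal: "\<And>y. diagonal (What y)"
    and What_W: "\<And>zB. What (transpose Dhat *v zB) = W zB"
    and F_im: "range (\<lambda>x. F *v x) = {y. Dhat *v y = 0}"
    and S_symmetric: "\<And>y. transpose (S y) = S y"
    and What_eq: "\<And>y. What y = hessian Ghat y + F ** S y ** transpose F"
    and S_integrable: "hessian_matrix_field S \<or> integrability_conditions S"
  shows "\<exists>Gs :: 'mh \<Rightarrow> real \<Rightarrow> real.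
           nonlinear_network Nhat Gs \<and>
           (\<forall>zB. Khat zB = associated_function Nhat Gs zB) \<and>
           (\<forall>zB. Khat zB = (\<Sum>j\<in>UNIV. Gs j ((transpose Dhat *v zB) $ j)))"
proof -
  let ?A = "transpose Dhat"
  have univ: "verts Nhat = UNIV" "arcs Nhat = UNIV"
    and bij: "bij_betw (\<lambda>e. {tail Nhat e, head Nhat e}) UNIV
      {{i, k} | i k. i \<noteq> k \<and> hessian Khat 0 $ i $ k \<noteq> 0}"
    using assumption_B[of 0]
    by (auto simp: kron_reduced_graph_at_def oriented_graph_of_matrix_def)
  have loopfree: "head Nhat e \<noteq> tail Nhat e" for e
    using bij_betwE[OF bij] by (force simp: doubleton_eq_iff)

  have "v $ i = v $ k" if "?A *v v = 0" for v i k
  proof (rule reduced_function_flat_direction[OF network splitting])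
    show "solves_constraints (associated_function N G) bnd zC"
      using assumption_A K_def by simp
    have "Khat (0 + v) = Khat 0" "Khat (0 - v) = Khat 0"
      using that by (simp_all add: Ghat_Khat matrix_vector_mult_diff_distrib
          matrix_vector_right_distrib del: add_0 diff_0)
    then show "reduced_function (associated_function N G) bnd zC (0 + v)
        = reduced_function (associated_function N G) bnd zC 0"
      "reduced_function (associated_function N G) bnd zC (0 - v)
        = reduced_function (associated_function N G) bnd zC 0"
      by (simp_all add: Khat_def K_def)
  qed
  then have connected: "Digraph_Component.connected Nhat"
    using connected_iff_potentials_constant[OF univ loopfree] Dhat_def by blast
  have graph: "network_graph Nhat"
    unfolding network_graph_def
    using univ loopfree connected by (auto intro!: loopfree_digraph.intro wf_digraph.intro
        loopfree_digraph_axioms.intro) metis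

  have "Dhat ** F = 0"
    using F_im by (auto simp: matrix_eq simp flip: matrix_vector_mul_assoc)
  then have "transpose F ** ?A = 0"
    using matrix_transpose_mul[of Dhat F] by (simp add: transpose_def vec_eq_iff)
  then have F_cut: "transpose F *v (?A *v z) = 0" for z
    by (simp add: matrix_vector_mul_assoc del: transpose_matrix_vector)
  have hess: "hessian Ghat y *v (?A *v z) = What y *v (?A *v z)" for y z
    by (simp add: What_eq matrix_vector_mult_add_rdistrib F_cut del: transpose_matrix_vector
        flip: matrix_vector_mul_assoc)
  have cut_space: "subspace (range ((*v) ?A))"
    by (intro subspace_UNIV linear_subspace_image matrix_vector_mul_linear)
  have separated: "(hessian Ghat y *v u) $ j = What y $ j $ j * u $ j"
    if "y \<in> range ((*v) ?A)" "u \<in> range ((*v) ?A)" for y u j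
    using that(2) hess diagonal_mult_component[OF What_diagonal] by (metis rangeE)
  have positive: "What y $ j $ j > 0" if "y \<in> range ((*v) ?A)" for y j
    using that What_W W_positive by (metis rangeE)
  have unit: "\<exists>u\<in>range ((*v) ?A). u $ j = 1" for j
  proof
    show "(?A *v axis (head Nhat j) 1) $ j = 1"
      using loopfree[of j]
      by (simp add: Dhat_def transpose_incidence_component axis_def
          del: transpose_matrix_vector)
  qed blast
  obtain Gs where Gs: "\<forall>j. strongly_convex (Gs j)"
      "\<forall>y\<in>range ((*v) ?A). Ghat y = (\<Sum>j\<in>UNIV. Gs j (y $ j))"
    using separable_on_subspace[where w = "\<lambda>y j. What y $ j $ j",
        OF Ghat_diff cut_space separated positive unit] by blast
  have "Khat zB = (\<Sum>j\<in>UNIV. Gs j ((?A *v zB) $ j))" for zB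
    unfolding Ghat_Khat by (rule bspec[OF Gs(2) rangeI])
  moreover from this have "Khat zB = associated_function Nhat Gs zB" for zB
    by (simp only: associated_function_def Dhat_def)
  moreover have "nonlinear_network Nhat Gs"
    using graph Gs(1) by (simp add: nonlinear_network_def)
  ultimately show ?thesis by blast
qed

end
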